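(* Let $(A,\alpha)$, $(B,\beta)$ be Lebesgue spaces and $\mathfrak P\in\mathrm{Pol}(A,B)$. Let $u=v+iw$ with $0\le v\le 1$, $w\in\mathbb R$, and let $p=1/v$, $q=1/(1-v)$ (with $1/0=\infty$). (a) There exists a linear operator $T_u(\mathfrak P):L^p(B)\to L^p(A)$ satisfying $$\int_A\bigl(T_u(\mathfrak P)g\bigr)(a)\,f(a)\,d\alpha(a)=S_u(\mathfrak P;f,g)$$ for all $g\in L^p(B)$ and all $f\in L^q(A)$, where $$S_u(\mathfrak P;f,g)=\iiint_{A\times B\times\mathbb R^\times}f(a)\,g(b)\,t^{u}\,d\mathfrak P(a,b,t).$$ (b) $\|T_u(\mathfrak P)\|_{L^p}\le 1$.
   Context: A Lebesgue space $(A,\alpha)$ is a space with a finite positive measure, $\alpha(A)>0$, isomorphic to a disjoint union of a finite (possibly empty) segment with Lebesgue measure and an at most countable collection of atoms. $\mathbb R^\times$ is the multiplicative group of positive reals, with coordinate $t$. A polymorphism from $(A,\alpha)$ to $(B,\beta)$ is a measure $\mathfrak P$ on $A\times B\times\mathbb R^\times$ such that the image of $\mathfrak P$ under the projection to $A$ is $\alpha$ and the image of $t\cdot\mathfrak P$ under the projection to $B$ is $\beta$. $\mathrm{Pol}(A,B)$ is the set of all polymorphisms. $\|\cdot\|_{L^p}$ in (b) is the operator norm from $L^p(B)$ to $L^p(A)$. *)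

theory Defs
  imports "HOL-Analysis.Analysis" "HOL-Probability.Essential_Supremum"
begin

section \<open>Lebesgue spaces\<close>

definition sum_measure :: "'a measure \<Rightarrow> 'b measure \<Rightarrow> ('a + 'b) measure" where
  "sum_measure M N = measure_of (space M <+> space N)
     {X. X \<subseteq> space M <+> space N \<and> Inl -` X \<in> sets M \<and> Inr -` X \<in> sets N}
     (\<lambda>X. emeasure M (Inl -` X) + emeasure N (Inr -` X))"

lemma sigma_algebra_sum:
  "sigma_algebra (space M <+> space N)
     {X. X \<subseteq> space M <+> space N \<and> Inl -` X \<in> sets M \<and> Inr -` X \<in> sets N}"
    (is "sigma_algebra ?S ?X")
proof -
  have compl: "?S - X \<in> ?X" if "X \<in> ?X" for X
  proof -
    have "Inl -` (?S - X) = space M - Inl -` X" "Inr -` (?S - X) = space N - Inr -` X"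
      by auto
    with that show ?thesis by auto
  qed
  have un: "(\<Union>i. F i) \<in> ?X" if "range F \<subseteq> ?X" for F :: "nat \<Rightarrow> _"
  proof -
    have "\<And>i. F i \<in> ?X" using that by auto
    then show ?thesis by (auto simp: vimage_UN)
  qed
  show ?thesis
    unfolding sigma_algebra_iff2 using compl un by auto
qed

lemma space_sum_measure [simp]: "space (sum_measure M N) = space M <+> space N"
  unfolding sum_measure_def by (rule space_measure_of) auto

lemma sets_sum_measure:
  "sets (sum_measure M N) =
     {X. X \<subseteq> space M <+> space N \<and> Inl -` X \<in> sets M \<and> Inr -` X \<in> sets N}"
  unfolding sum_measure_def
  by (rule sigma_algebra.sets_measure_of_eq[OF sigma_algebra_sum])

lemma emeasure_sum_measure:
  assumes "X \<in> sets (sum_measure M N)"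
  shows "emeasure (sum_measure M N) X = emeasure M (Inl -` X) + emeasure N (Inr -` X)"
proof (rule emeasure_measure_of[OF sum_measure_def])
  show "countably_additive (sets (sum_measure M N))
          (\<lambda>X. emeasure M (Inl -` X) + emeasure N (Inr -` X))"
  proof (rule countably_additiveI)
    fix F :: "nat \<Rightarrow> _"
    assume F: "range F \<subseteq> sets (sum_measure M N)" "disjoint_family F"
    have m: "\<And>i. Inl -` F i \<in> sets M" "\<And>i. Inr -` F i \<in> sets N"
      using F(1) by (auto simp: sets_sum_measure)
    have d: "disjoint_family (\<lambda>i. Inl -` F i)" "disjoint_family (\<lambda>i. Inr -` F i)"
      using F(2) by (auto simp: disjoint_family_on_def)
    show "(\<Sum>i. emeasure M (Inl -` F i) + emeasure N (Inr -` F i))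
        = emeasure M (Inl -` \<Union> (range F)) + emeasure N (Inr -` \<Union> (range F))"
      using m d by (simp add: suminf_add[symmetric] vimage_UN suminf_emeasure image_subset_iff)
  qed
qed (use assms in \<open>auto simp: positive_def\<close>)

definition isomorphic_measures :: "'a measure \<Rightarrow> 'b measure \<Rightarrow> bool" where
  "isomorphic_measures M N \<longleftrightarrow>
     (\<exists>\<phi>. bij_betw \<phi> (space M) (space N) \<and> \<phi> \<in> M \<rightarrow>\<^sub>M N \<and>
          the_inv_into (space M) \<phi> \<in> N \<rightarrow>\<^sub>M M \<and> distr M N \<phi> = N)"

text \<open>Isomorphisms of Lebesgue spaces are, as usual, understood modulo sets of measure zero.\<close>

definition isomorphic_mod0 :: "'a measure \<Rightarrow> 'b measure \<Rightarrow> bool" where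
  "isomorphic_mod0 M N \<longleftrightarrow>
     (\<exists>X\<in>null_sets M. \<exists>Y\<in>null_sets N.
        isomorphic_measures (restrict_space M (space M - X)) (restrict_space N (space N - Y)))"

text \<open>The segment is empty if \<open>d < c\<close>; the atoms are the points of \<open>I\<close>, which may be
  empty, finite or countably infinite, and the atom \<open>i\<close> has mass \<open>m i\<close>.\<close>

definition lebesgue_space :: "'a measure \<Rightarrow> bool" where
  "lebesgue_space A \<longleftrightarrow>
     finite_measure A \<and> emeasure A (space A) > 0 \<and>
     (\<exists>(c::real) d (I::nat set) (m::nat \<Rightarrow> ennreal).
        (\<forall>i\<in>I. 0 < m i) \<and>
        isomorphic_mod0 A (sum_measure (lebesgue_on {c..d}) (point_measure I m)))"


section \<open>Polymorphisms\<close>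

definition Rtimes :: "real measure" where
  "Rtimes = restrict_space borel {0<..}"

definition Pol :: "'a measure \<Rightarrow> 'b measure \<Rightarrow> ('a \<times> 'b \<times> real) measure set" where
  "Pol A B = {P. sets P = sets (A \<Otimes>\<^sub>M (B \<Otimes>\<^sub>M Rtimes)) \<and>
     distr P A (\<lambda>(a, b, t). a) = A \<and>
     distr (density P (\<lambda>(a, b, t). ennreal t)) B (\<lambda>(a, b, t). b) = B}"

definition S_integrand ::
  "complex \<Rightarrow> ('a \<Rightarrow> complex) \<Rightarrow> ('b \<Rightarrow> complex) \<Rightarrow> 'a \<times> 'b \<times> real \<Rightarrow> complex" where
  "S_integrand u f g = (\<lambda>(a, b, t). f a * g b * complex_of_real t powr u)"

definition S_form ::
  "complex \<Rightarrow> ('a \<times> 'b \<times> real) measure \<Rightarrow> ('a \<Rightarrow> complex) \<Rightarrow> ('b \<Rightarrow> complex) \<Rightarrow> complex" where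
  "S_form u P f g = integral\<^sup>L P (S_integrand u f g)"


section \<open>Complex Lebesgue function spaces and their operators\<close>

definition Lp_space :: "ennreal \<Rightarrow> 'a measure \<Rightarrow> ('a \<Rightarrow> complex) set" where
  "Lp_space p M = {f \<in> borel_measurable M.
     if p = \<infinity> then esssup M (\<lambda>x. ereal (norm (f x))) < \<infinity>
     else integrable M (\<lambda>x. norm (f x) powr enn2real p)}"

definition Lp_norm :: "ennreal \<Rightarrow> 'a measure \<Rightarrow> ('a \<Rightarrow> complex) \<Rightarrow> real" where
  "Lp_norm p M f =
     (if p = \<infinity> then real_of_ereal (esssup M (\<lambda>x. ereal (norm (f x))))
      else (\<integral>x. norm (f x) powr enn2real p \<partial>M) powr (1 / enn2real p))"

text \<open>Elements of \<open>L\<^sup>p\<close> are represented by functions, with almost everywhere equality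
  as their equality.  A linear operator \<open>L\<^sup>p(B) \<rightarrow> L\<^sup>p(A)\<close> is therefore a map on
  representatives that respects this equality and is linear with respect to it.\<close>

definition Lp_linear_operator ::
  "ennreal \<Rightarrow> 'b measure \<Rightarrow> 'a measure \<Rightarrow> (('b \<Rightarrow> complex) \<Rightarrow> ('a \<Rightarrow> complex)) \<Rightarrow> bool" where
  "Lp_linear_operator p B A T \<longleftrightarrow>
     (\<forall>g\<in>Lp_space p B. T g \<in> Lp_space p A) \<and>
     (\<forall>g\<in>Lp_space p B. \<forall>h\<in>Lp_space p B.
        (AE b in B. g b = h b) \<longrightarrow> (AE a in A. T g a = T h a)) \<and>
     (\<forall>g\<in>Lp_space p B. \<forall>h\<in>Lp_space p B.
        AE a in A. T (\<lambda>b. g b + h b) a = T g a + T h a) \<and>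
     (\<forall>c. \<forall>g\<in>Lp_space p B. AE a in A. T (\<lambda>b. c * g b) a = c * T g a)"

definition Lp_operator_norm ::
  "ennreal \<Rightarrow> 'b measure \<Rightarrow> 'a measure \<Rightarrow> (('b \<Rightarrow> complex) \<Rightarrow> ('a \<Rightarrow> complex)) \<Rightarrow> ennreal" where
  "Lp_operator_norm p B A T =
     (SUP g \<in> {g \<in> Lp_space p B. Lp_norm p B g \<le> 1}. ennreal (Lp_norm p A (T g)))"

text \<open>The integrability conditions express that both sides of the defining identity of
  \<open>T\<^sub>u(P)\<close> converge; \<^term>\<open>integral\<^sup>L\<close> alone would return 0 for a divergent integral.\<close>

definition represents_S ::
  "complex \<Rightarrow> ennreal \<Rightarrow> ennreal \<Rightarrow> 'a measure \<Rightarrow> 'b measure \<Rightarrow> ('a \<times> 'b \<times> real) measure \<Rightarrow>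
   (('b \<Rightarrow> complex) \<Rightarrow> ('a \<Rightarrow> complex)) \<Rightarrow> bool" where
  "represents_S u p q A B P T \<longleftrightarrow>
     (\<forall>g\<in>Lp_space p B. \<forall>f\<in>Lp_space q A.
        integrable P (S_integrand u f g) \<and>
        integrable A (\<lambda>a. T g a * f a) \<and>
        (\<integral>a. T g a * f a \<partial>A) = S_form u P f g)"

end

theory Submission
  imports Defs
begin

text \<open>The measure \<open>P\<close> carries two structures: the projection \<open>\<pi>\<close> to \<open>A\<close> maps \<open>P\<close> itself to the
  measure of \<open>A\<close>, while the projection to \<open>B\<close> maps \<open>t \<cdot> P\<close> to the measure of \<open>B\<close>. A function
  \<open>g\<close> on \<open>B\<close> is sent to the function \<open>h(a,b,t) = g(b) t\<^sup>u\<close> on \<open>A \<times> B \<times> \<real>\<^sup>\<times>\<close>. Since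
  \<open>\<bar>t\<^sup>u\<bar> = t\<^sup>v\<close> and \<open>p v = 1\<close>, one has \<open>\<bar>h\<bar>\<^sup>p = \<bar>g\<bar>\<^sup>p t\<close>, so by the second marginal
  condition \<open>g \<mapsto> h\<close> maps \<open>L\<^sup>p(B)\<close> to \<open>L\<^sup>p(P)\<close> without increasing norms; the limiting case
  \<open>p = \<infinity>\<close> holds because \<open>\<bar>t\<^sup>i\<^sup>w\<bar> = 1\<close> (\<open>twisted_pullback_Lp\<close>).
  The form \<open>S\<^sub>u(P; f, g)\<close> is the integral of \<open>(f \<circ> \<pi>) h\<close> over \<open>P\<close>.
  Integrating \<open>h\<close> over the fibres of \<open>\<pi>\<close>, that is, taking its conditional expectation as a
  function on \<open>A\<close>, therefore gives an operator that represents \<open>S\<^sub>u\<close>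
  (\<open>fiber_expectation_exists\<close>, a consequence of the Radon-Nikodym theorem).

  The norm bound rests on duality (\<open>fiber_contraction\<close>). It starts from
  the identity between \<open>\<integral> k f\<close> and \<open>\<integral> (f \<circ> \<pi>) h\<close> for \<open>k = T g\<close> and bounded \<open>f\<close>: choosing \<open>f\<close> as the
  conjugate phase of \<open>k\<close> times a truncation of \<open>\<bar>k\<bar>\<^sup>p\<^sup>-\<^sup>1\<close>, Young's inequality bounds the
  \<open>p\<close>-th power integral of \<open>k\<close> by that of \<open>h\<close>; for \<open>p = \<infinity>\<close> the conjugate
  phase is restricted to the set where \<open>\<bar>k\<bar>\<close> exceeds the bound. Hence one argument shows both that the operator
  constructed here takes values in \<open>L\<^sup>p(A)\<close> and that every operator representing \<open>S\<^sub>u\<close> has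
  norm at most 1.\<close>

section \<open>Conjugate exponents and Lebesgue function spaces\<close>

lemma enn2real_inverse_exponent:
  assumes "0 < v"
  shows "1 / ennreal v \<noteq> \<infinity>" and "enn2real (1 / ennreal v) = 1 / v"
proof -
  have "1 / ennreal v = ennreal (1 / v)"
    using assms by (metis divide_ennreal ennreal_1 zero_le_one)
  then show "1 / ennreal v \<noteq> \<infinity>" "enn2real (1 / ennreal v) = 1 / v"
    using assms by auto
qed

lemma inverse_exponent_zero: "1 / ennreal 0 = \<infinity>"
  by simp

lemma Lp_space_finite_iff:
  assumes "0 < v"
  shows "f \<in> Lp_space (1 / ennreal v) M \<longleftrightarrow>
     f \<in> borel_measurable M \<and> integrable M (\<lambda>x. norm (f x) powr (1 / v))"
  using enn2real_inverse_exponent[OF assms] by (simp add: Lp_space_def)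

lemma Lp_norm_finite:
  assumes "0 < v"
  shows "Lp_norm (1 / ennreal v) M f = (\<integral>x. norm (f x) powr (1 / v) \<partial>M) powr v"
  using enn2real_inverse_exponent[OF assms] by (simp add: Lp_norm_def)

lemma Lp_space_measurable: "f \<in> Lp_space p M \<Longrightarrow> f \<in> borel_measurable M"
  by (simp add: Lp_space_def)

lemma Lp_space_infinityI:
  assumes "f \<in> borel_measurable M" and "AE x in M. norm (f x) \<le> C"
  shows "f \<in> Lp_space \<infinity> M"
proof -
  have "esssup M (\<lambda>x. ereal (norm (f x))) \<le> ereal C"
    using assms by (intro esssup_I) auto
  then have "esssup M (\<lambda>x. ereal (norm (f x))) < \<infinity>"
    by (rule le_less_trans) simp
  with assms(1) show ?thesis by (simp add: Lp_space_def)
qed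

lemma Lp_norm_infinity_le:
  assumes "f \<in> borel_measurable M" and "AE x in M. norm (f x) \<le> C" and "0 \<le> C"
  shows "Lp_norm \<infinity> M f \<le> C"
proof -
  have "esssup M (\<lambda>x. ereal (norm (f x))) \<le> ereal C"
    using assms by (intro esssup_I) auto
  then show ?thesis
    using assms(3) by (cases "esssup M (\<lambda>x. ereal (norm (f x)))") (auto simp: Lp_norm_def)
qed

lemma AE_norm_le_Lp_norm_infinity:
  assumes "f \<in> Lp_space \<infinity> M"
  shows "AE x in M. norm (f x) \<le> Lp_norm \<infinity> M f"
proof -
  (* On a null space the essential supremum is -\<infinity> and its conversion to a real number
     is 0; there the
     claim is vacuous. *)
  have fin: "esssup M (\<lambda>x. ereal (norm (f x))) < \<infinity>"
    using assms by (simp add: Lp_space_def)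
  have "AE x in M. ereal (norm (f x)) \<le> esssup M (\<lambda>x. ereal (norm (f x)))"
    by (rule esssup_AE)
  then show ?thesis
    by eventually_elim
      (use fin in \<open>cases "esssup M (\<lambda>x. ereal (norm (f x)))"; auto simp: Lp_norm_def\<close>)
qed

lemma Lp_norm_infinity_nonneg:
  assumes "f \<in> borel_measurable M"
  shows "0 \<le> Lp_norm \<infinity> M f"
proof (rule ccontr)
  assume neg: "\<not> 0 \<le> Lp_norm \<infinity> M f"
  let ?e = "esssup M (\<lambda>x. ereal (norm (f x)))"
  (* A finite negative essential supremum forces the space to be null, but then it is -\<infinity>. *)
  have "real_of_ereal ?e < 0" using neg by (simp add: Lp_norm_def)
  then have e: "?e < 0 \<and> ?e \<noteq> -\<infinity>" by (cases ?e) auto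
  have "AE x in M. ereal (norm (f x)) \<le> ?e" by (rule esssup_AE)
  then have "AE x in M. ereal (norm (f x)) \<le> -\<infinity>"
  proof eventually_elim
    case (elim x)
    then have "ereal (norm (f x)) < 0" by (rule le_less_trans[OF _ conjunct1[OF e]])
    then show ?case by simp
  qed
  then have "?e \<le> -\<infinity>" by (rule esssup_I[rotated]) (use assms in measurable)
  with e show False by simp
qed

lemma bounded_in_Lp_space:
  assumes "finite_measure M" and [measurable]: "f \<in> borel_measurable M"
    and "\<And>x. norm (f x) \<le> C" and "0 \<le> v"
  shows "f \<in> Lp_space (1 / ennreal v) M"
proof (cases "v = 0")
  case True
  show ?thesis
    unfolding True inverse_exponent_zero
    by (rule Lp_space_infinityI[OF assms(2), where C = C]) (simp add: assms(3))
next
  case False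
  interpret finite_measure M by fact
  have "integrable M (\<lambda>x. norm (f x) powr (1 / v))"
  proof (rule integrable_const_bound)
    show "AE x in M. norm (norm (f x) powr (1 / v)) \<le> C powr (1 / v)"
      using assms(4) by (intro always_eventually allI) (simp add: powr_mono2 assms(3))
  qed measurable
  then show ?thesis using assms False by (simp add: Lp_space_finite_iff)
qed

text \<open>Young's inequality in the form that pairs a function with the \<open>p - 1\<close>st power of another,
  the extremal test function for the \<open>L\<^sup>p\<close> norm. In this form it covers \<open>p = 1\<close>.\<close>

lemma Young_powr:
  fixes x m p :: real
  assumes "0 \<le> x" and "0 \<le> m" and "1 \<le> p"
  shows "x * m powr (p - 1) \<le> x powr p / p + (1 - 1 / p) * m powr p"
proof (cases "x = 0 \<or> m = 0")
  case True
  then show ?thesis using assms by (auto intro!: add_nonneg_nonneg mult_nonneg_nonneg)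
next
  case False
  then have "(x powr p) powr (1 / p) * (m powr p) powr (1 - 1 / p)
      \<le> (1 / p) * x powr p + (1 - 1 / p) * m powr p"
    using assms by (intro Youngs_inequality_0) auto
  moreover have "(x powr p) powr (1 / p) = x" "(m powr p) powr (1 - 1 / p) = m powr (p - 1)"
    using assms False by (auto simp: powr_powr algebra_simps)
  ultimately show ?thesis by simp
qed

lemma integrable_bounded_mult:
  fixes f g :: "'a \<Rightarrow> complex"
  assumes "f \<in> Lp_space \<infinity> M" and "g \<in> Lp_space (1 / ennreal 1) M"
  shows "integrable M (\<lambda>x. f x * g x)"
proof (rule Bochner_Integration.integrable_bound)
  have [measurable]: "f \<in> borel_measurable M" "g \<in> borel_measurable M"
    using assms by (auto dest: Lp_space_measurable)
  show "(\<lambda>x. f x * g x) \<in> borel_measurable M" by measurable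
  show "integrable M (\<lambda>x. Lp_norm \<infinity> M f * norm (g x))"
    using assms(2) Lp_space_finite_iff[of 1 g M] by simp
  show "AE x in M. norm (f x * g x) \<le> norm (Lp_norm \<infinity> M f * norm (g x))"
    using AE_norm_le_Lp_norm_infinity[OF assms(1)]
    by eventually_elim (auto simp: norm_mult abs_mult intro!: mult_right_mono)
qed

text \<open>The exponents are given by their reciprocals \<open>v\<close> and \<open>1 - v\<close>, so that both endpoint pairs
  are included. Only integrability of the product is at stake, so the pointwise Young inequality
  replaces the Hoelder inequality.\<close>

lemma integrable_conjugate_mult:
  fixes f g :: "'a \<Rightarrow> complex"
  assumes "0 \<le> v" and "v \<le> 1"
    and f: "f \<in> Lp_space (1 / ennreal v) M" and g: "g \<in> Lp_space (1 / ennreal (1 - v)) M"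
  shows "integrable M (\<lambda>x. f x * g x)"
proof -
  consider "v = 0" | "v = 1" | "0 < v" "v < 1" using assms by linarith
  then show ?thesis
  proof cases
    case 1
    then show ?thesis using f g integrable_bounded_mult[of f M g] by simp
  next
    case 2
    then show ?thesis using f g integrable_bounded_mult[of g M f] by (simp add: mult.commute)
  next
    case 3
    have [measurable]: "f \<in> borel_measurable M" "g \<in> borel_measurable M"
      using f g by (auto dest: Lp_space_measurable)
    let ?F = "\<lambda>x. norm (f x) powr (1 / v)" and ?G = "\<lambda>x. norm (g x) powr (1 / (1 - v))"
    show ?thesis
    proof (rule Bochner_Integration.integrable_bound)
      show "integrable M (\<lambda>x. v * ?F x + (1 - v) * ?G x)"
        using f g 3 by (simp add: Lp_space_finite_iff)
      show "(\<lambda>x. f x * g x) \<in> borel_measurable M" by measurable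
      have "norm (f x) * norm (g x) \<le> v * ?F x + (1 - v) * ?G x" for x
      proof (cases "f x = 0 \<or> g x = 0")
        case True
        then show ?thesis using 3 by (auto intro!: add_nonneg_nonneg mult_nonneg_nonneg)
      next
        case False
        then have "?F x powr v * ?G x powr (1 - v) \<le> v * ?F x + (1 - v) * ?G x"
          using 3 by (intro Youngs_inequality_0) auto
        then show ?thesis using 3 by (simp add: powr_powr)
      qed
      then show "AE x in M. norm (f x * g x) \<le> norm (v * ?F x + (1 - v) * ?G x)"
        by (intro always_eventually allI) (simp add: norm_mult order_trans[OF _ abs_ge_self])
    qed
  qed
qed

lemma Lp_space_pullback:
  assumes \<pi>: "\<pi> \<in> M \<rightarrow>\<^sub>M N" and d: "distr M N \<pi> = N" and "0 \<le> v"
    and f: "f \<in> Lp_space (1 / ennreal v) N"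
  shows "(\<lambda>x. f (\<pi> x)) \<in> Lp_space (1 / ennreal v) M"
proof (cases "v = 0")
  case True
  have fm: "f \<in> borel_measurable N" using f by (rule Lp_space_measurable)
  have "f \<in> Lp_space \<infinity> N" using f unfolding True inverse_exponent_zero .
  then have "AE y in distr M N \<pi>. norm (f y) \<le> Lp_norm \<infinity> N f"
    unfolding d by (rule AE_norm_le_Lp_norm_infinity)
  then have C: "AE x in M. norm (f (\<pi> x)) \<le> Lp_norm \<infinity> N f" by (rule AE_distrD[OF \<pi>])
  show ?thesis
    unfolding True inverse_exponent_zero
    by (rule Lp_space_infinityI[OF measurable_compose[OF \<pi> fm] C])
next
  case False
  then have v: "0 < v" using assms by simp
  have m[measurable]: "f \<in> borel_measurable N" using f by (rule Lp_space_measurable)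
  have "integrable (distr M N \<pi>) (\<lambda>x. norm (f x) powr (1 / v))"
    using f v by (simp add: Lp_space_finite_iff d)
  then have "integrable M (\<lambda>x. norm (f (\<pi> x)) powr (1 / v))"
    by (subst (asm) integrable_distr_eq[OF \<pi>]) measurable
  then show ?thesis using v measurable_compose[OF \<pi> m] by (simp add: Lp_space_finite_iff)
qed

section \<open>Integration over the fibres of a measure-preserving map\<close>

text \<open>Conditional expectation with respect to the map \<open>\<pi>\<close>, regarded as a function \<open>k\<close> on the
  target rather than on the source. It is tested against every measurable \<open>f\<close> for which
  the integral over the source converges, because \<open>S\<^sub>u\<close> has to be represented for unbounded \<open>f\<close>
  as well.\<close>

definition fiber_expectation ::
  "'m measure \<Rightarrow> 'a measure \<Rightarrow> ('m \<Rightarrow> 'a) \<Rightarrow> ('m \<Rightarrow> complex) \<Rightarrow> ('a \<Rightarrow> complex) \<Rightarrow> bool" where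
  "fiber_expectation M N \<pi> h k \<longleftrightarrow>
     k \<in> borel_measurable N \<and>
     (\<forall>f\<in>borel_measurable N. integrable M (\<lambda>x. f (\<pi> x) * h x) \<longrightarrow>
        integrable N (\<lambda>y. k y * f y) \<and> (\<integral>y. k y * f y \<partial>N) = (\<integral>x. f (\<pi> x) * h x \<partial>M))"

text \<open>The image of \<open>h \<cdot> M\<close> under \<open>\<pi>\<close> is absolutely continuous with respect to the image of \<open>M\<close>,
  which is \<open>N\<close>, so the Radon-Nikodym theorem provides the density. Integrability of \<open>h\<close> makes the
  image measure finite, which allows a real-valued density.\<close>

lemma nonneg_fiber_density_exists:
  fixes h :: "'m \<Rightarrow> real"
  assumes "finite_measure N" and \<pi>[measurable]: "\<pi> \<in> M \<rightarrow>\<^sub>M N" and d: "distr M N \<pi> = N"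
    and h: "integrable M h" "\<And>x. 0 \<le> h x"
  obtains k where "k \<in> borel_measurable N" and "\<And>y. 0 \<le> k y"
    and "distr (density M (\<lambda>x. ennreal (h x))) N \<pi> = density N (\<lambda>y. ennreal (k y))"
proof -
  interpret N: finite_measure N by fact
  have [measurable]: "h \<in> borel_measurable M" using h(1) by simp
  let ?D = "density M (\<lambda>x. ennreal (h x))" and ?Q = "distr (density M (\<lambda>x. ennreal (h x))) N \<pi>"
  have \<pi>D: "\<pi> \<in> ?D \<rightarrow>\<^sub>M N" by simp
  have fin: "finite_measure ?Q"
  proof
    have "emeasure ?D (space ?D) = (\<integral>\<^sup>+x. ennreal (h x) \<partial>M)"
      by (subst emeasure_density) (auto intro!: nn_integral_cong)
    also have "\<dots> < \<infinity>" using h by (simp add: nn_integral_eq_integral)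
    finally show "emeasure ?Q (space ?Q) \<noteq> \<infinity>"
      using measurable_space[OF \<pi>D]
      by (subst emeasure_distr[OF \<pi>D]) (auto simp: vimage_inter_cong[of "space M"] Int_absorb1 subset_eq)
  qed
  have ac: "absolutely_continuous N ?Q"
    unfolding absolutely_continuous_def
  proof
    fix X assume X: "X \<in> null_sets N"
    then have [measurable]: "X \<in> sets N" by auto
    have "X \<in> null_sets (distr M N \<pi>)" using X by (simp add: d)
    then have "\<pi> -` X \<inter> space M \<in> null_sets M" by (simp add: null_sets_distr_iff)
    then have "\<pi> -` X \<inter> space M \<in> null_sets ?D"
      using absolutely_continuousI_density[of "\<lambda>x. ennreal (h x)" M]
      by (auto simp: absolutely_continuous_def)
    then show "X \<in> null_sets ?Q" by (simp add: null_sets_distr_iff)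
  qed
  obtain k where k: "k \<in> borel_measurable N" "AE y in N. RN_deriv N ?Q y = ennreal (k y)"
      "\<And>y. 0 \<le> k y"
    by (rule N.real_RN_deriv[OF fin ac]) auto
  have "?Q = density N (RN_deriv N ?Q)" using ac by (simp add: N.density_RN_deriv)
  also have "\<dots> = density N (\<lambda>y. ennreal (k y))"
    using k by (intro density_cong) auto
  finally show thesis using k that by blast
qed

lemma nonneg_fiber_expectation_exists:
  fixes h :: "'m \<Rightarrow> real"
  assumes "finite_measure N" and \<pi>[measurable]: "\<pi> \<in> M \<rightarrow>\<^sub>M N" and "distr M N \<pi> = N"
    and h: "integrable M h" "\<And>x. 0 \<le> h x"
  shows "\<exists>k. fiber_expectation M N \<pi> (\<lambda>x. complex_of_real (h x)) k"
proof -
  obtain k where k: "k \<in> borel_measurable N" "\<And>y. 0 \<le> k y"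
      "distr (density M (\<lambda>x. ennreal (h x))) N \<pi> = density N (\<lambda>y. ennreal (k y))"
    using nonneg_fiber_density_exists[OF assms] by blast
  have [measurable]: "h \<in> borel_measurable M" "k \<in> borel_measurable N" using h(1) k(1) by auto
  let ?D = "density M (\<lambda>x. ennreal (h x))"
  have "fiber_expectation M N \<pi> (\<lambda>x. complex_of_real (h x)) (\<lambda>y. complex_of_real (k y))"
    unfolding fiber_expectation_def
  proof (intro conjI ballI impI)
    show "(\<lambda>y. complex_of_real (k y)) \<in> borel_measurable N" by measurable
    fix f :: "_ \<Rightarrow> complex" assume [measurable]: "f \<in> borel_measurable N"
    assume i: "integrable M (\<lambda>x. f (\<pi> x) * complex_of_real (h x))"
    have \<pi>D: "\<pi> \<in> ?D \<rightarrow>\<^sub>M N" by simp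
    have "integrable ?D (\<lambda>x. f (\<pi> x))"
      using i h(2) by (subst integrable_density) (auto simp: scaleR_conv_of_real mult.commute)
    then have "integrable (distr ?D N \<pi>) f"
      using \<pi>D by (subst integrable_distr_eq) auto
    then have "integrable (density N (\<lambda>y. ennreal (k y))) f" by (simp only: k(3))
    then show "integrable N (\<lambda>y. complex_of_real (k y) * f y)"
      using k(2) by (subst (asm) integrable_density) (auto simp: scaleR_conv_of_real)
    have "(\<integral>y. complex_of_real (k y) * f y \<partial>N) = integral\<^sup>L (density N (\<lambda>y. ennreal (k y))) f"
      using k(2) by (subst integral_density) (auto simp: scaleR_conv_of_real)
    also have "\<dots> = integral\<^sup>L (distr ?D N \<pi>) f" by (simp only: k(3))
    also have "\<dots> = (\<integral>x. f (\<pi> x) \<partial>?D)"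
      using \<pi>D by (subst integral_distr) auto
    also have "\<dots> = (\<integral>x. f (\<pi> x) * complex_of_real (h x) \<partial>M)"
      using h(2) by (subst integral_density) (auto simp: scaleR_conv_of_real mult.commute)
    finally show "(\<integral>y. complex_of_real (k y) * f y \<partial>N)
        = (\<integral>x. f (\<pi> x) * complex_of_real (h x) \<partial>M)" .
  qed
  then show ?thesis by blast
qed

text \<open>A complex integrand is split into the positive and negative parts of its real and imaginary
  parts. Each part is dominated by \<open>\<bar>h\<bar>\<close>, so a test function that is admissible for \<open>h\<close> is
  admissible for all four.\<close>

lemma fiber_expectation_exists:
  fixes h :: "'m \<Rightarrow> complex"
  assumes N: "finite_measure N" and \<pi>[measurable]: "\<pi> \<in> M \<rightarrow>\<^sub>M N" and d: "distr M N \<pi> = N"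
    and h: "integrable M h"
  shows "\<exists>k. fiber_expectation M N \<pi> h k"
proof -
  define part :: "nat \<Rightarrow> 'm \<Rightarrow> real" where
    "part j x = (if j = 0 then max 0 (Re (h x)) else if j = 1 then max 0 (- Re (h x))
       else if j = 2 then max 0 (Im (h x)) else max 0 (- Im (h x)))" for j x
  have hm[measurable]: "h \<in> borel_measurable M" using h by simp
  have part_meas[measurable]: "part j \<in> borel_measurable M" for j
    unfolding part_def by measurable
  have part_le: "part j x \<le> norm (h x)" for j x
    using abs_Re_le_cmod[of "h x"] abs_Im_le_cmod[of "h x"] unfolding part_def by auto
  have part_nonneg: "0 \<le> part j x" for j x unfolding part_def by auto
  have part_int: "integrable M (part j)" for j
    using h part_le part_nonneg
    by (intro Bochner_Integration.integrable_bound[OF integrable_norm[OF h]]) auto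
  have "\<forall>j. \<exists>k. fiber_expectation M N \<pi> (\<lambda>x. complex_of_real (part j x)) k"
    using nonneg_fiber_expectation_exists[OF N \<pi> d part_int part_nonneg] by blast
  then obtain k where k: "\<And>j. fiber_expectation M N \<pi> (\<lambda>x. complex_of_real (part j x)) (k j)"
    by metis
  have [measurable]: "k j \<in> borel_measurable N" for j
    using k[of j] by (simp add: fiber_expectation_def)
  have h_eq: "h x = part 0 x - part 1 x + \<i> * part 2 x - \<i> * part 3 x" for x
    by (auto simp: complex_eq_iff part_def)
  have "fiber_expectation M N \<pi> h (\<lambda>y. k 0 y - k 1 y + \<i> * k 2 y - \<i> * k 3 y)"
    unfolding fiber_expectation_def
  proof (intro conjI ballI impI)
    show "(\<lambda>y. k 0 y - k 1 y + \<i> * k 2 y - \<i> * k 3 y) \<in> borel_measurable N" by measurable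
    fix f :: "_ \<Rightarrow> complex" assume f[measurable]: "f \<in> borel_measurable N"
    assume i: "integrable M (\<lambda>x. f (\<pi> x) * h x)"
    have ij: "integrable M (\<lambda>x. f (\<pi> x) * complex_of_real (part j x))" for j
      using part_le part_nonneg
      by (intro Bochner_Integration.integrable_bound[OF i])
        (auto simp: norm_mult intro!: mult_left_mono)
    have kj: "integrable N (\<lambda>y. k j y * f y)"
      "(\<integral>y. k j y * f y \<partial>N) = (\<integral>x. f (\<pi> x) * complex_of_real (part j x) \<partial>M)" for j
      using k[of j] f ij[of j] by (auto simp: fiber_expectation_def)
    have e: "(\<lambda>y. (k 0 y - k 1 y + \<i> * k 2 y - \<i> * k 3 y) * f y)
      = (\<lambda>y. k 0 y * f y - k 1 y * f y + \<i> * (k 2 y * f y) - \<i> * (k 3 y * f y))"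
      by (auto simp: algebra_simps)
    have e': "(\<lambda>x. f (\<pi> x) * h x) = (\<lambda>x. f (\<pi> x) * part 0 x - f (\<pi> x) * part 1 x
        + \<i> * (f (\<pi> x) * part 2 x) - \<i> * (f (\<pi> x) * part 3 x))"
      by (subst h_eq) (auto simp: algebra_simps)
    show "integrable N (\<lambda>y. (k 0 y - k 1 y + \<i> * k 2 y - \<i> * k 3 y) * f y)"
      unfolding e using kj(1) by simp
    show "(\<integral>y. (k 0 y - k 1 y + \<i> * k 2 y - \<i> * k 3 y) * f y \<partial>N) = (\<integral>x. f (\<pi> x) * h x \<partial>M)"
      unfolding e e' using kj ij by simp
  qed
  then show ?thesis by blast
qed

lemma integrable_mult_bounded:
  fixes f h :: "'m \<Rightarrow> complex"
  assumes "integrable M h" and [measurable]: "f \<in> borel_measurable M" and "\<And>x. norm (f x) \<le> C"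
  shows "integrable M (\<lambda>x. f x * h x)"
proof (rule Bochner_Integration.integrable_bound)
  show "integrable M (\<lambda>x. C * norm (h x))" using assms by simp
  show "(\<lambda>x. f x * h x) \<in> borel_measurable M" using assms by measurable
  show "AE x in M. norm (f x * h x) \<le> norm (C * norm (h x))"
    using assms(3) order_trans[OF norm_ge_zero assms(3)]
    by (intro always_eventually allI) (auto simp: norm_mult abs_mult intro!: mult_right_mono)
qed

lemma fiber_expectation_test:
  assumes k: "fiber_expectation M N \<pi> h k" and h: "integrable M h" and [measurable]: "\<pi> \<in> M \<rightarrow>\<^sub>M N"
    and f[measurable]: "f \<in> borel_measurable N" and b: "\<And>y. norm (f y) \<le> C"
  shows "integrable N (\<lambda>y. k y * f y)" and "(\<integral>y. k y * f y \<partial>N) = (\<integral>x. f (\<pi> x) * h x \<partial>M)"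
proof -
  have "integrable M (\<lambda>x. f (\<pi> x) * h x)"
    using b by (intro integrable_mult_bounded[OF h, where C = C]) auto
  then show "integrable N (\<lambda>y. k y * f y)" "(\<integral>y. k y * f y \<partial>N) = (\<integral>x. f (\<pi> x) * h x \<partial>M)"
    using k f by (auto simp: fiber_expectation_def)
qed

lemma norm_cnj_sgn_le: "norm (cnj (sgn z)) \<le> 1"
  by (simp add: norm_sgn)

lemma mult_cnj_sgn: "z * cnj (sgn z) = complex_of_real (norm z)"
proof (cases "z = 0")
  case False
  have "z * cnj (sgn z) = (z * cnj z) / norm z" by (simp add: sgn_eq)
  then show ?thesis using False by (simp add: complex_norm_square[symmetric] power2_eq_square)
qed simp

lemma borel_measurable_cnj_sgn [measurable]:
  "f \<in> borel_measurable M \<Longrightarrow> (\<lambda>x. cnj (sgn (f x))) \<in> borel_measurable M"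
  unfolding sgn_div_norm
  by (rule borel_measurable_continuous_on[of cnj]) (auto intro!: continuous_intros)

text \<open>Testing against the conjugate phase of \<open>k\<close> computes the \<open>L\<^sup>1\<close> norm of \<open>k\<close>.\<close>

lemma AE_zero_if_tests_zero:
  fixes k :: "'a \<Rightarrow> complex"
  assumes i: "integrable N k"
    and z: "\<And>f. f \<in> borel_measurable N \<Longrightarrow> (\<And>y. norm (f y) \<le> 1) \<Longrightarrow> (\<integral>y. k y * f y \<partial>N) = 0"
  shows "AE y in N. k y = 0"
proof -
  have [measurable]: "k \<in> borel_measurable N" using i by simp
  have "(\<integral>y. k y * cnj (sgn (k y)) \<partial>N) = 0"
    by (rule z) (auto simp: norm_sgn)
  then have "(\<integral>y. norm (k y) \<partial>N) = 0" by (simp add: mult_cnj_sgn)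
  then show ?thesis using i by (simp add: integral_nonneg_eq_0_iff_AE)
qed

text \<open>A fibre expectation is determined by its test integrals, and these depend linearly on the
  integrand. The combination is only required to hold almost everywhere, so the case
  \<open>c = 1\<close>, \<open>c' = 0\<close> says that almost equal integrands have almost equal fibre expectations.\<close>

lemma fiber_expectation_linear:
  assumes k: "fiber_expectation M N \<pi> h k" and k': "fiber_expectation M N \<pi> h' k'"
    and s: "fiber_expectation M N \<pi> hs s"
    and h: "integrable M h" "integrable M h'" "integrable M hs" and \<pi>: "\<pi> \<in> M \<rightarrow>\<^sub>M N"
    and e: "AE x in M. hs x = c * h x + c' * h' x"
  shows "AE y in N. s y = c * k y + c' * k' y"
proof -
  note t = fiber_expectation_test[OF k h(1) \<pi>] and t' = fiber_expectation_test[OF k' h(2) \<pi>]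
    and ts = fiber_expectation_test[OF s h(3) \<pi>]
  have i: "integrable N k" "integrable N k'" "integrable N s"
    using t(1)[of "\<lambda>_. 1" 1] t'(1)[of "\<lambda>_. 1" 1] ts(1)[of "\<lambda>_. 1" 1] by auto
  have "AE y in N. s y - (c * k y + c' * k' y) = 0"
  proof (rule AE_zero_if_tests_zero)
    show "integrable N (\<lambda>y. s y - (c * k y + c' * k' y))" using i by simp
    fix f :: "_ \<Rightarrow> complex" assume f[measurable]: "f \<in> borel_measurable N" and b: "\<And>y. norm (f y) \<le> 1"
    have [measurable]: "h \<in> borel_measurable M" "h' \<in> borel_measurable M" "hs \<in> borel_measurable M"
      using h by auto
    have fi: "integrable M (\<lambda>x. f (\<pi> x) * h x)" "integrable M (\<lambda>x. f (\<pi> x) * h' x)"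
      using h b measurable_compose[OF \<pi> f] by (auto intro!: integrable_mult_bounded[where C = 1])
    have "(\<integral>x. f (\<pi> x) * hs x \<partial>M) = (\<integral>x. c * (f (\<pi> x) * h x) + c' * (f (\<pi> x) * h' x) \<partial>M)"
      using e \<pi> by (intro integral_cong_AE) (auto simp: algebra_simps)
    also have "\<dots> = c * (\<integral>x. f (\<pi> x) * h x \<partial>M) + c' * (\<integral>x. f (\<pi> x) * h' x \<partial>M)"
      using fi by simp
    finally have "(\<integral>y. s y * f y \<partial>N) = c * (\<integral>y. k y * f y \<partial>N) + c' * (\<integral>y. k' y * f y \<partial>N)"
      using t[OF f b] t'[OF f b] ts[OF f b] by simp
    then show "(\<integral>y. (s y - (c * k y + c' * k' y)) * f y \<partial>N) = 0"
      using t(1)[OF f b] t'(1)[OF f b] ts(1)[OF f b]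
      by (simp add: left_diff_distrib distrib_right mult.assoc)
  qed
  then show ?thesis by simp
qed

section \<open>The contraction property\<close>

text \<open>With \<open>m = min \<bar>k\<bar> n\<close> and \<open>f\<close> the conjugate phase of \<open>k\<close> times \<open>m\<^sup>p\<^sup>-\<^sup>1\<close>, one has
  \<open>\<integral> m\<^sup>p \<le> \<integral> k f = \<integral> (f \<circ> \<pi>) h \<le> \<integral> \<bar>h\<bar>\<^sup>p / p + (1 - 1/p) \<integral> m\<^sup>p\<close>. The integral of \<open>m\<^sup>p\<close> is finite
  thanks to the truncation and can be moved to the left, which leaves \<open>\<integral> m\<^sup>p \<le> \<integral> \<bar>h\<bar>\<^sup>p\<close>; then
  \<open>n \<rightarrow> \<infinity>\<close> by monotone convergence.\<close>

lemma contraction_finite_exponent: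
  fixes h :: "'m \<Rightarrow> complex" and k :: "'a \<Rightarrow> complex"
  assumes N: "finite_measure N" and \<pi>[measurable]: "\<pi> \<in> M \<rightarrow>\<^sub>M N" and d: "distr M N \<pi> = N"
    and p: "1 \<le> p" and h[measurable]: "h \<in> borel_measurable M"
    and hp: "integrable M (\<lambda>x. norm (h x) powr p)"
    and k[measurable]: "k \<in> borel_measurable N"
    and t: "\<And>f C. f \<in> borel_measurable N \<Longrightarrow> (\<And>y. norm (f y) \<le> C) \<Longrightarrow>
        integrable N (\<lambda>y. k y * f y) \<and> integrable M (\<lambda>x. f (\<pi> x) * h x) \<and>
        (\<integral>y. k y * f y \<partial>N) = (\<integral>x. f (\<pi> x) * h x \<partial>M)"
  shows "integrable N (\<lambda>y. norm (k y) powr p)"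
    and "(\<integral>y. norm (k y) powr p \<partial>N) \<le> (\<integral>x. norm (h x) powr p \<partial>M)"
proof -
  interpret N: finite_measure N by fact
  let ?H = "\<integral>x. norm (h x) powr p \<partial>M"
  define m where "m n y = min (norm (k y)) (real n)" for n y
  have [measurable]: "m n \<in> borel_measurable N" for n unfolding m_def by measurable
  have m0: "0 \<le> m n y" "m n y \<le> real n" "m n y \<le> norm (k y)" for n y by (auto simp: m_def)
  have mp: "integrable N (\<lambda>y. m n y powr p)" for n
    using m0 p by (intro N.integrable_const_bound[where B = "real n powr p"]) (auto intro!: powr_mono2)
  have X: "(\<integral>y. m n y powr p \<partial>N) \<le> ?H" for n
  proof -
    let ?f = "\<lambda>y. cnj (sgn (k y)) * complex_of_real (m n y powr (p - 1))"
    have f[measurable]: "?f \<in> borel_measurable N" by measurable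
    have fle: "norm (?f y) \<le> m n y powr (p - 1)" for y
      using mult_right_mono[OF norm_cnj_sgn_le[of "k y"], of "m n y powr (p - 1)"]
      by (simp add: norm_mult)
    moreover have "m n y powr (p - 1) \<le> real n powr (p - 1)" for y
      using m0 p by (intro powr_mono2) auto
    ultimately have b: "norm (?f y) \<le> real n powr (p - 1)" for y using order_trans by blast
    note t' = t[of ?f, OF f b]
    have kf: "k y * ?f y = complex_of_real (norm (k y) * m n y powr (p - 1))" for y
      using mult_cnj_sgn[of "k y"] by (simp add: mult.assoc[symmetric])
    have i1: "integrable N (\<lambda>y. norm (k y) * m n y powr (p - 1))"
      using t' unfolding kf complex_of_real_integrable_eq by simp
    have mpi: "integrable M (\<lambda>x. m n (\<pi> x) powr p)"
      using mp[of n] by (subst (asm) d[symmetric], subst (asm) integrable_distr_eq) auto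
    have me: "(\<integral>x. m n (\<pi> x) powr p \<partial>M) = (\<integral>y. m n y powr p \<partial>N)"
      using integral_distr[OF \<pi>, of "\<lambda>y. m n y powr p"] by (simp add: d)
    have mm: "m n y powr p \<le> norm (k y) * m n y powr (p - 1)" for y
    proof -
      have "m n y powr p = m n y * m n y powr (p - 1)"
        using m0(1)[of n y] by (cases "m n y = 0") (auto simp: powr_diff)
      then show ?thesis using m0 by (simp add: mult_right_mono)
    qed
    have "(\<integral>y. m n y powr p \<partial>N) \<le> (\<integral>y. norm (k y) * m n y powr (p - 1) \<partial>N)"
      by (rule integral_mono[OF mp i1 mm])
    also have "\<dots> = norm (\<integral>y. k y * ?f y \<partial>N)"
      unfolding kf integral_complex_of_real
      using integral_nonneg_AE[of "\<lambda>y. norm (k y) * m n y powr (p - 1)" N] by simp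
    also have "\<dots> = norm (\<integral>x. ?f (\<pi> x) * h x \<partial>M)" using t' by simp
    also have "\<dots> \<le> (\<integral>x. norm (?f (\<pi> x) * h x) \<partial>M)" by (rule integral_norm_bound)
    also have "\<dots> \<le> (\<integral>x. norm (h x) powr p / p + (1 - 1 / p) * m n (\<pi> x) powr p \<partial>M)"
    proof (rule integral_mono)
      show "integrable M (\<lambda>x. norm (?f (\<pi> x) * h x))" using t' by (intro integrable_norm) simp
      show "integrable M (\<lambda>x. norm (h x) powr p / p + (1 - 1 / p) * m n (\<pi> x) powr p)"
        using hp mpi by simp
      fix x
      have "norm (?f (\<pi> x) * h x) \<le> norm (h x) * m n (\<pi> x) powr (p - 1)"
        using mult_left_mono[OF fle[of "\<pi> x"], of "norm (h x)"] by (simp add: norm_mult mult_ac)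
      also have "\<dots> \<le> norm (h x) powr p / p + (1 - 1 / p) * m n (\<pi> x) powr p"
        using m0 p by (intro Young_powr) auto
      finally show "norm (?f (\<pi> x) * h x) \<le> norm (h x) powr p / p + (1 - 1 / p) * m n (\<pi> x) powr p" .
    qed
    also have "\<dots> = ?H / p + (1 - 1 / p) * (\<integral>y. m n y powr p \<partial>N)"
      using hp mpi by (simp add: me)
    finally have "(\<integral>y. m n y powr p \<partial>N) / p \<le> ?H / p" by (simp add: algebra_simps)
    then show ?thesis using p by (simp add: divide_le_cancel)
  qed
  have lim: "(\<lambda>n. \<integral>\<^sup>+y. ennreal (m n y powr p) \<partial>N) \<longlonglongrightarrow> (\<integral>\<^sup>+y. ennreal (norm (k y) powr p) \<partial>N)"
  proof (rule nn_integral_LIMSEQ)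
    show "incseq (\<lambda>n y. ennreal (m n y powr p))"
      using p by (auto simp: incseq_def le_fun_def m_def intro!: ennreal_leI powr_mono2)
    fix y
    have "eventually (\<lambda>n. ennreal (m n y powr p) = ennreal (norm (k y) powr p)) sequentially"
      using eventually_ge_at_top[of "nat \<lceil>norm (k y)\<rceil>"]
    proof eventually_elim
      case (elim n)
      then have "norm (k y) \<le> real n" by linarith
      then show ?case by (simp add: m_def)
    qed
    then show "(\<lambda>n. ennreal (m n y powr p)) \<longlonglongrightarrow> ennreal (norm (k y) powr p)"
      by (rule tendsto_eventually)
  qed simp
  have le: "(\<integral>\<^sup>+y. ennreal (norm (k y) powr p) \<partial>N) \<le> ennreal ?H"
  proof (rule LIMSEQ_le_const2[OF lim], intro exI allI impI)
    fix n
    have "(\<integral>\<^sup>+y. ennreal (m n y powr p) \<partial>N) = ennreal (\<integral>y. m n y powr p \<partial>N)"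
      using mp by (intro nn_integral_eq_integral) auto
    then show "(\<integral>\<^sup>+y. ennreal (m n y powr p) \<partial>N) \<le> ennreal ?H" using X by (simp add: ennreal_leI)
  qed
  show i: "integrable N (\<lambda>y. norm (k y) powr p)"
    using le by (intro integrableI_nonneg) (auto intro: le_less_trans)
  have "ennreal (\<integral>y. norm (k y) powr p \<partial>N) \<le> ennreal ?H"
    using le i by (simp add: nn_integral_eq_integral)
  then show "(\<integral>y. norm (k y) powr p \<partial>N) \<le> ?H"
    by (subst (asm) ennreal_le_iff) auto
qed

text \<open>Here the test function is the conjugate phase of \<open>k\<close> on the set where \<open>\<bar>k\<bar> > C\<close>. On that set
  the integral of \<open>\<bar>k\<bar>\<close> is at most \<open>C\<close> times its measure, so the set is null.\<close>

lemma contraction_infinite_exponent: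
  fixes h :: "'m \<Rightarrow> complex" and k :: "'a \<Rightarrow> complex"
  assumes N: "finite_measure N" and \<pi>[measurable]: "\<pi> \<in> M \<rightarrow>\<^sub>M N" and d: "distr M N \<pi> = N"
    and h[measurable]: "h \<in> borel_measurable M"
    and hC: "AE x in M. norm (h x) \<le> C"
    and k[measurable]: "k \<in> borel_measurable N"
    and t: "\<And>f C. f \<in> borel_measurable N \<Longrightarrow> (\<And>y. norm (f y) \<le> C) \<Longrightarrow>
        integrable N (\<lambda>y. k y * f y) \<and> integrable M (\<lambda>x. f (\<pi> x) * h x) \<and>
        (\<integral>y. k y * f y \<partial>N) = (\<integral>x. f (\<pi> x) * h x \<partial>M)"
  shows "AE y in N. norm (k y) \<le> C"
proof -
  interpret N: finite_measure N by fact
  (* the indicator function of the set where the bound fails *)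
  define e where "e y = (if norm (k y) > C then 1 else 0 :: real)" for y
  have [measurable]: "e \<in> borel_measurable N" unfolding e_def by measurable
  have e: "0 \<le> e y" "e y \<le> 1" for y by (auto simp: e_def)
  let ?f = "\<lambda>y. cnj (sgn (k y)) * complex_of_real (e y)"
  have f[measurable]: "?f \<in> borel_measurable N" by measurable
  have fle: "norm (?f y) \<le> e y" for y
    using mult_right_mono[OF norm_cnj_sgn_le[of "k y"], of "e y"] e[of y] by (simp add: norm_mult)
  then have b: "norm (?f y) \<le> 1" for y using e order_trans by blast
  note t' = t[of ?f, OF f b]
  have kf: "k y * ?f y = complex_of_real (norm (k y) * e y)" for y
    using mult_cnj_sgn[of "k y"] by (simp add: mult.assoc[symmetric])
  have i1: "integrable N (\<lambda>y. norm (k y) * e y)"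
    using t' unfolding kf complex_of_real_integrable_eq by simp
  have ei: "integrable N e" using e by (intro N.integrable_const_bound[where B = 1]) auto
  have eM: "integrable M (\<lambda>x. e (\<pi> x))"
    using ei by (subst (asm) d[symmetric], subst (asm) integrable_distr_eq) auto
  have ee: "(\<integral>x. e (\<pi> x) \<partial>M) = (\<integral>y. e y \<partial>N)"
    using integral_distr[OF \<pi>, of e] by (simp add: d)
  have "(\<integral>y. norm (k y) * e y \<partial>N) = norm (\<integral>y. k y * ?f y \<partial>N)"
    unfolding kf integral_complex_of_real
    using integral_nonneg_AE[of "\<lambda>y. norm (k y) * e y" N] e by simp
  also have "\<dots> = norm (\<integral>x. ?f (\<pi> x) * h x \<partial>M)" using t' by simp
  also have "\<dots> \<le> (\<integral>x. norm (?f (\<pi> x) * h x) \<partial>M)" by (rule integral_norm_bound)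
  also have "\<dots> \<le> (\<integral>x. C * e (\<pi> x) \<partial>M)"
  proof (rule integral_mono_AE)
    show "integrable M (\<lambda>x. norm (?f (\<pi> x) * h x))" using t' by (intro integrable_norm) simp
    show "integrable M (\<lambda>x. C * e (\<pi> x))" using eM by simp
    show "AE x in M. norm (?f (\<pi> x) * h x) \<le> C * e (\<pi> x)"
      using hC
    proof eventually_elim
      case (elim x)
      have "norm (h x) * norm (?f (\<pi> x)) \<le> C * e (\<pi> x)"
        using elim fle[of "\<pi> x"] by (intro mult_mono) (auto intro: order_trans[OF norm_ge_zero])
      then show ?case by (simp add: norm_mult mult_ac)
    qed
  qed
  also have "\<dots> = (\<integral>y. C * e y \<partial>N)" using ee by simp
  finally have "(\<integral>y. norm (k y) * e y - C * e y \<partial>N) \<le> 0"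
    using i1 ei by simp
  moreover have nn: "0 \<le> norm (k y) * e y - C * e y" for y by (auto simp: e_def)
  ultimately have "(\<integral>y. norm (k y) * e y - C * e y \<partial>N) = 0"
    by (intro antisym integral_nonneg_AE) auto
  then have "AE y in N. norm (k y) * e y - C * e y = 0"
    using i1 ei nn by (subst (asm) integral_nonneg_eq_0_iff_AE) auto
  then show ?thesis by eventually_elim (auto simp: e_def split: if_splits)
qed

text \<open>The two exponent ranges combined. That \<open>k\<close> lies in \<open>L\<^sup>p\<close> is a conclusion, so the lemma can be
  used to construct the operator as well as to estimate its norm.\<close>

lemma fiber_contraction:
  fixes h :: "'m \<Rightarrow> complex" and k :: "'a \<Rightarrow> complex"
  assumes N: "finite_measure N" and \<pi>: "\<pi> \<in> M \<rightarrow>\<^sub>M N" and d: "distr M N \<pi> = N"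
    and v: "0 \<le> v" "v \<le> 1" and h: "h \<in> Lp_space (1 / ennreal v) M"
    and k: "k \<in> borel_measurable N"
    and t: "\<And>f C. f \<in> borel_measurable N \<Longrightarrow> (\<And>y. norm (f y) \<le> C) \<Longrightarrow>
        integrable N (\<lambda>y. k y * f y) \<and> integrable M (\<lambda>x. f (\<pi> x) * h x) \<and>
        (\<integral>y. k y * f y \<partial>N) = (\<integral>x. f (\<pi> x) * h x \<partial>M)"
  shows "k \<in> Lp_space (1 / ennreal v) N"
    and "Lp_norm (1 / ennreal v) N k \<le> Lp_norm (1 / ennreal v) M h"
proof -
  have hm: "h \<in> borel_measurable M" using h by (rule Lp_space_measurable)
  have "k \<in> Lp_space (1 / ennreal v) N \<and> Lp_norm (1 / ennreal v) N k \<le> Lp_norm (1 / ennreal v) M h"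
  proof (cases "v = 0")
    case True
    have hC: "AE x in M. norm (h x) \<le> Lp_norm \<infinity> M h"
      using h unfolding True inverse_exponent_zero by (rule AE_norm_le_Lp_norm_infinity)
    have c: "AE y in N. norm (k y) \<le> Lp_norm \<infinity> M h"
      by (rule contraction_infinite_exponent[OF N \<pi> d hm hC k]) (rule t)
    show ?thesis
      unfolding True inverse_exponent_zero
      using Lp_space_infinityI[OF k c] Lp_norm_infinity_le[OF k c Lp_norm_infinity_nonneg[OF hm]]
      by blast
  next
    case False
    then have v0: "0 < v" and p: "1 \<le> 1 / v" using v by auto
    have hp: "integrable M (\<lambda>x. norm (h x) powr (1 / v))" using h v0 by (simp add: Lp_space_finite_iff)
    have "integrable N (\<lambda>y. norm (k y) powr (1 / v))"
      by (rule contraction_finite_exponent(1)[OF N \<pi> d p hm hp k]) (rule t)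
    moreover have "(\<integral>y. norm (k y) powr (1 / v) \<partial>N) \<le> (\<integral>x. norm (h x) powr (1 / v) \<partial>M)"
      by (rule contraction_finite_exponent(2)[OF N \<pi> d p hm hp k]) (rule t)
    ultimately show ?thesis using k v0
      by (auto simp: Lp_space_finite_iff Lp_norm_finite intro!: powr_mono2)
  qed
  then show "k \<in> Lp_space (1 / ennreal v) N"
    "Lp_norm (1 / ennreal v) N k \<le> Lp_norm (1 / ennreal v) M h" by auto
qed

section \<open>Polymorphisms\<close>

definition twisted_pullback :: "complex \<Rightarrow> ('b \<Rightarrow> complex) \<Rightarrow> 'a \<times> 'b \<times> real \<Rightarrow> complex" where
  "twisted_pullback u g = (\<lambda>(a, b, t). g b * complex_of_real t powr u)"

locale polymorphism =
  fixes A :: "'a measure" and B :: "'b measure" and P :: "('a \<times> 'b \<times> real) measure"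
  assumes finite_A: "finite_measure A" and P_Pol: "P \<in> Pol A B"
begin

lemma sets_P: "sets P = sets (A \<Otimes>\<^sub>M (B \<Otimes>\<^sub>M Rtimes))"
  using P_Pol by (simp add: Pol_def)

lemma proj_A [measurable]: "(\<lambda>(a, b, t). a) \<in> P \<rightarrow>\<^sub>M A"
  unfolding measurable_cong_sets[OF sets_P refl] by measurable

lemma proj_B [measurable]: "(\<lambda>(a, b, t). b) \<in> P \<rightarrow>\<^sub>M B"
  unfolding measurable_cong_sets[OF sets_P refl] by measurable

lemma proj_t [measurable]: "(\<lambda>(a, b, t). t) \<in> borel_measurable P"
proof -
  have [measurable]: "(\<lambda>t. t) \<in> borel_measurable Rtimes"
    unfolding Rtimes_def by (intro measurable_restrict_space1) simp
  show ?thesis unfolding measurable_cong_sets[OF sets_P refl] by measurable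
qed

lemma t_pos: "(a, b, t) \<in> space P \<Longrightarrow> 0 < t"
  using sets_eq_imp_space_eq[OF sets_P] by (simp add: space_pair_measure Rtimes_def)

lemma marginal_A: "distr P A (\<lambda>(a, b, t). a) = A"
  using P_Pol by (simp add: Pol_def)

lemma marginal_B: "distr (density P (\<lambda>(a, b, t). ennreal t)) B (\<lambda>(a, b, t). b) = B"
  using P_Pol by (simp add: Pol_def)

lemma density_eq: "(\<lambda>(a, b, t). ennreal t) = (\<lambda>x. ennreal ((\<lambda>(a, b, t). t) x))"
  by auto

text \<open>The second marginal condition concerns \<open>t \<cdot> P\<close>, not \<open>P\<close>; since \<open>t > 0\<close>, both measures have
  the same null sets, and statements that hold almost everywhere on \<open>B\<close> can be pulled back to
  \<open>P\<close>.\<close>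

lemma AE_B_pullback:
  assumes "AE b in B. Q b"
  shows "AE (a, b, t) in P. Q b"
proof -
  let ?D = "density P (\<lambda>(a, b, t). ennreal t)"
  have m: "(\<lambda>(a, b, t). b) \<in> ?D \<rightarrow>\<^sub>M B" using proj_B by simp
  have "AE b in distr ?D B (\<lambda>(a, b, t). b). Q b" using assms unfolding marginal_B .
  then have "AE x in ?D. Q ((\<lambda>(a, b, t). b) x)" using m by (rule AE_distrD[rotated])
  then have "AE x in P. 0 < (\<lambda>(a, b, t). ennreal t) x \<longrightarrow> Q ((\<lambda>(a, b, t). b) x)"
    by (subst (asm) AE_density) (auto simp: density_eq)
  then show ?thesis using AE_space
    by eventually_elim (auto dest: t_pos)
qed

lemma integral_B_pullback:
  fixes F :: "'b \<Rightarrow> real"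
  assumes [measurable]: "F \<in> borel_measurable B"
  shows "integrable P (\<lambda>(a, b, t). t * F b) \<longleftrightarrow> integrable B F"
    and "(\<integral>(a, b, t). t * F b \<partial>P) = (\<integral>b. F b \<partial>B)"
proof -
  let ?D = "density P (\<lambda>x. ennreal ((\<lambda>(a, b, t). t) x))"
  have m: "(\<lambda>(a, b, t). b) \<in> ?D \<rightarrow>\<^sub>M B" using proj_B by simp
  have nn: "AE x in P. 0 \<le> (\<lambda>(a, b, t). t) x" using AE_space by eventually_elim (auto dest: t_pos)
  have Fm: "(\<lambda>x. F ((\<lambda>(a, b, t). b) x)) \<in> borel_measurable P" by (rule measurable_compose[OF proj_B]) simp
  have e: "(\<lambda>(a, b, t). t * F b) = (\<lambda>x. (\<lambda>(a, b, t). t) x *\<^sub>R F ((\<lambda>(a, b, t). b) x))" by auto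
  have BB: "distr ?D B (\<lambda>(a, b, t). b) = B" using marginal_B by (simp add: density_eq)
  have "integrable B F \<longleftrightarrow> integrable (distr ?D B (\<lambda>(a, b, t). b)) F" by (simp only: BB)
  also have "\<dots> \<longleftrightarrow> integrable P (\<lambda>(a, b, t). t * F b)"
    unfolding integrable_distr_eq[OF m assms] e by (rule integrable_density[OF Fm proj_t nn])
  finally show "integrable P (\<lambda>(a, b, t). t * F b) \<longleftrightarrow> integrable B F" by simp
  have "(\<integral>b. F b \<partial>B) = integral\<^sup>L (distr ?D B (\<lambda>(a, b, t). b)) F" by (simp only: BB)
  also have "\<dots> = (\<integral>(a, b, t). t * F b \<partial>P)"
    unfolding integral_distr[OF m assms] e by (rule integral_density[OF Fm proj_t nn])
  finally show "(\<integral>(a, b, t). t * F b \<partial>P) = (\<integral>b. F b \<partial>B)" by simp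
qed

lemma twisted_pullback_measurable:
  assumes [measurable]: "g \<in> borel_measurable B"
  shows "twisted_pullback u g \<in> borel_measurable P"
proof -
  have "(\<lambda>x. g ((\<lambda>(a, b, t). b) x) * exp (u * complex_of_real (ln ((\<lambda>(a, b, t). t) x))))
      \<in> borel_measurable P"
    using measurable_compose[OF proj_B assms] by measurable
  also have "?this \<longleftrightarrow> ?thesis"
    by (intro measurable_cong) (auto simp: twisted_pullback_def powr_def Ln_of_real dest: t_pos)
  finally show ?thesis .
qed

lemma norm_twisted_pullback:
  assumes "(a, b, t) \<in> space P"
  shows "norm (twisted_pullback u g (a, b, t)) = norm (g b) * t powr Re u"
  using t_pos[OF assms] by (simp add: twisted_pullback_def norm_mult norm_powr_real_powr)

text \<open>For \<open>v > 0\<close> the identity \<open>(\<bar>g\<bar> t\<^sup>v)\<^sup>1\<^sup>/\<^sup>v = t \<bar>g\<bar>\<^sup>1\<^sup>/\<^sup>v\<close> reduces the claim to the second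
  marginal condition, with equality of norms. For \<open>v = 0\<close> the factor \<open>t\<^sup>u\<close> has modulus 1.\<close>

lemma twisted_pullback_Lp:
  assumes v: "0 \<le> v" "v \<le> 1" and u: "Re u = v" and g: "g \<in> Lp_space (1 / ennreal v) B"
  shows "twisted_pullback u g \<in> Lp_space (1 / ennreal v) P"
    and "Lp_norm (1 / ennreal v) P (twisted_pullback u g) \<le> Lp_norm (1 / ennreal v) B g"
proof -
  let ?h = "twisted_pullback u g"
  have gm[measurable]: "g \<in> borel_measurable B" using g by (rule Lp_space_measurable)
  have hm: "?h \<in> borel_measurable P" using twisted_pullback_measurable gm by blast
  have "?h \<in> Lp_space (1 / ennreal v) P \<and> Lp_norm (1 / ennreal v) P ?h \<le> Lp_norm (1 / ennreal v) B g"
  proof (cases "v = 0")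
    case True
    have "AE b in B. norm (g b) \<le> Lp_norm \<infinity> B g"
      using g unfolding True inverse_exponent_zero by (rule AE_norm_le_Lp_norm_infinity)
    then have "AE (a, b, t) in P. norm (g b) \<le> Lp_norm \<infinity> B g" by (rule AE_B_pullback)
    then have hC: "AE x in P. norm (?h x) \<le> Lp_norm \<infinity> B g"
      using AE_space by eventually_elim (use True u in \<open>auto simp: norm_twisted_pullback dest: t_pos\<close>)
    show ?thesis
      unfolding True inverse_exponent_zero
      using Lp_space_infinityI[OF hm hC] Lp_norm_infinity_le[OF hm hC Lp_norm_infinity_nonneg[OF gm]]
      by blast
  next
    case False
    then have v0: "0 < v" using v by simp
    let ?F = "\<lambda>b. norm (g b) powr (1 / v)"
    have eq: "norm (?h x) powr (1 / v) = (case x of (a, b, t) \<Rightarrow> t * ?F b)" if "x \<in> space P" for x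
      using that v0 u t_pos
      by (cases x) (auto simp: norm_twisted_pullback powr_mult powr_powr mult.commute abs_of_pos)
    have Fm: "?F \<in> borel_measurable B" by measurable
    have "integrable P (\<lambda>x. norm (?h x) powr (1 / v)) \<longleftrightarrow> integrable P (\<lambda>(a, b, t). t * ?F b)"
      using eq by (intro Bochner_Integration.integrable_cong) auto
    also have "\<dots> \<longleftrightarrow> integrable B ?F" by (rule integral_B_pullback(1)[OF Fm])
    finally have i: "integrable P (\<lambda>x. norm (?h x) powr (1 / v))"
      using g v0 by (simp add: Lp_space_finite_iff)
    have "(\<integral>x. norm (?h x) powr (1 / v) \<partial>P) = (\<integral>(a, b, t). t * ?F b \<partial>P)"
      using eq by (intro Bochner_Integration.integral_cong) auto
    also have "\<dots> = (\<integral>b. ?F b \<partial>B)" by (rule integral_B_pullback(2)[OF Fm])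
    finally show ?thesis using i hm v0 by (simp add: Lp_space_finite_iff Lp_norm_finite)
  qed
  then show "?h \<in> Lp_space (1 / ennreal v) P"
    "Lp_norm (1 / ennreal v) P ?h \<le> Lp_norm (1 / ennreal v) B g" by auto
qed

lemma S_integrand_eq:
  "S_integrand u f g = (\<lambda>x. f ((\<lambda>(a, b, t). a) x) * twisted_pullback u g x)"
  by (auto simp: S_integrand_def twisted_pullback_def)

lemma S_integrable:
  assumes v: "0 \<le> v" "v \<le> 1" and u: "Re u = v"
    and g: "g \<in> Lp_space (1 / ennreal v) B" and f: "f \<in> Lp_space (1 / ennreal (1 - v)) A"
  shows "integrable P (S_integrand u f g)"
proof -
  have "integrable P (\<lambda>x. twisted_pullback u g x * f ((\<lambda>(a, b, t). a) x))"
    using v by (intro integrable_conjugate_mult[OF v] twisted_pullback_Lp[OF v u g]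
        Lp_space_pullback[OF proj_A marginal_A _ f]) simp
  then show ?thesis by (simp add: S_integrand_eq mult.commute)
qed

text \<open>Constants lie in every \<open>L\<^sup>q(A)\<close> because \<open>A\<close> is finite, so integrability of \<open>h\<close> is the
  case \<open>f = 1\<close> of the convergence of \<open>S\<^sub>u\<close>.\<close>

lemma twisted_pullback_integrable:
  assumes v: "0 \<le> v" "v \<le> 1" and u: "Re u = v" and g: "g \<in> Lp_space (1 / ennreal v) B"
  shows "integrable P (twisted_pullback u g)"
proof -
  have "(\<lambda>_. 1) \<in> Lp_space (1 / ennreal (1 - v)) A"
    using v by (intro bounded_in_Lp_space[OF finite_A, where C = 1]) auto
  from S_integrable[OF v u g this] show ?thesis by (simp add: S_integrand_eq)
qed

definition polymorphism_operator :: "complex \<Rightarrow> ('b \<Rightarrow> complex) \<Rightarrow> ('a \<Rightarrow> complex)" where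
  "polymorphism_operator u g =
     (SOME k. fiber_expectation P A (\<lambda>(a, b, t). a) (twisted_pullback u g) k)"

lemma polymorphism_operator:
  assumes "integrable P (twisted_pullback u g)"
  shows "fiber_expectation P A (\<lambda>(a, b, t). a) (twisted_pullback u g) (polymorphism_operator u g)"
  unfolding polymorphism_operator_def
  by (rule someI_ex[OF fiber_expectation_exists[OF finite_A proj_A marginal_A assms]])

lemma polymorphism_operator_linear:
  assumes v: "0 \<le> v" "v \<le> 1" and u: "Re u = v"
  shows "Lp_linear_operator (1 / ennreal v) B A (polymorphism_operator u)"
proof -
  let ?T = "polymorphism_operator u" and ?p = "1 / ennreal v" and ?h = "twisted_pullback u"
  note int = twisted_pullback_integrable[OF v u]
  note fe = polymorphism_operator[OF int]
  show ?thesis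
    unfolding Lp_linear_operator_def
  proof (intro conjI ballI allI impI)
    fix g assume g: "g \<in> Lp_space ?p B"
    have km: "?T g \<in> borel_measurable A" using fe[OF g] by (simp add: fiber_expectation_def)
    show "?T g \<in> Lp_space ?p A"
    proof (rule fiber_contraction(1)[OF finite_A proj_A marginal_A v twisted_pullback_Lp(1)[OF v u g] km])
      fix f :: "'a \<Rightarrow> complex" and C
      assume f: "f \<in> borel_measurable A" and b: "\<And>y. norm (f y) \<le> C"
      show "integrable A (\<lambda>y. ?T g y * f y) \<and>
          integrable P (\<lambda>x. f ((\<lambda>(a, b, t). a) x) * ?h g x) \<and>
          (\<integral>y. ?T g y * f y \<partial>A) = (\<integral>x. f ((\<lambda>(a, b, t). a) x) * ?h g x \<partial>P)"
        using fiber_expectation_test[OF fe[OF g] int[OF g] proj_A f b]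
          integrable_mult_bounded[OF int[OF g] measurable_compose[OF proj_A f] b] by blast
    qed
  next
    fix g g' assume g: "g \<in> Lp_space ?p B" "g' \<in> Lp_space ?p B" and e: "AE b in B. g b = g' b"
    have "AE (a, b, t) in P. g b = g' b" by (rule AE_B_pullback[OF e])
    then have "AE x in P. ?h g x = 1 * ?h g' x + 0 * ?h g' x"
      by eventually_elim (auto simp: twisted_pullback_def)
    from fiber_expectation_linear[OF fe[OF g(2)] fe[OF g(2)] fe[OF g(1)]
        int[OF g(2)] int[OF g(2)] int[OF g(1)] proj_A this]
    show "AE a in A. ?T g a = ?T g' a" by simp
  next
    fix g g' assume g: "g \<in> Lp_space ?p B" "g' \<in> Lp_space ?p B"
    have e: "?h (\<lambda>b. g b + g' b) = (\<lambda>x. ?h g x + ?h g' x)"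
      by (auto simp: twisted_pullback_def algebra_simps)
    have i: "integrable P (?h (\<lambda>b. g b + g' b))" unfolding e using int g by simp
    have "AE x in P. ?h (\<lambda>b. g b + g' b) x = 1 * ?h g x + 1 * ?h g' x" by (simp add: e)
    from fiber_expectation_linear[OF fe[OF g(1)] fe[OF g(2)] polymorphism_operator[OF i]
        int[OF g(1)] int[OF g(2)] i proj_A this]
    show "AE a in A. ?T (\<lambda>b. g b + g' b) a = ?T g a + ?T g' a" by simp
  next
    fix c g assume g: "g \<in> Lp_space ?p B"
    have e: "?h (\<lambda>b. c * g b) = (\<lambda>x. c * ?h g x)"
      by (auto simp: twisted_pullback_def algebra_simps)
    have i: "integrable P (?h (\<lambda>b. c * g b))" unfolding e using int g by simp
    have "AE x in P. ?h (\<lambda>b. c * g b) x = c * ?h g x + 0 * ?h g x" by (simp add: e)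
    from fiber_expectation_linear[OF fe[OF g] fe[OF g] polymorphism_operator[OF i]
        int[OF g] int[OF g] i proj_A this]
    show "AE a in A. ?T (\<lambda>b. c * g b) a = c * ?T g a" by simp
  qed
qed

lemma polymorphism_operator_represents:
  assumes v: "0 \<le> v" "v \<le> 1" and u: "Re u = v"
  shows "represents_S u (1 / ennreal v) (1 / ennreal (1 - v)) A B P (polymorphism_operator u)"
  unfolding represents_S_def
proof (intro ballI)
  fix g f assume g: "g \<in> Lp_space (1 / ennreal v) B" and f: "f \<in> Lp_space (1 / ennreal (1 - v)) A"
  have S: "integrable P (S_integrand u f g)" by (rule S_integrable[OF v u g f])
  show "integrable P (S_integrand u f g) \<and> integrable A (\<lambda>a. polymorphism_operator u g a * f a) \<and>
      (\<integral>a. polymorphism_operator u g a * f a \<partial>A) = S_form u P f g"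
    using polymorphism_operator[OF twisted_pullback_integrable[OF v u g]] S Lp_space_measurable[OF f]
    unfolding S_form_def S_integrand_eq fiber_expectation_def by simp
qed

text \<open>Bounded functions belong to \<open>L\<^sup>q(A)\<close>, so the representation of \<open>S\<^sub>u\<close> supplies all the test
  integrals that the contraction principle asks for.\<close>

lemma representing_operator_norm_le_1:
  assumes v: "0 \<le> v" "v \<le> 1" and u: "Re u = v"
    and T: "Lp_linear_operator (1 / ennreal v) B A T"
    and S: "represents_S u (1 / ennreal v) (1 / ennreal (1 - v)) A B P T"
  shows "Lp_operator_norm (1 / ennreal v) B A T \<le> 1"
  unfolding Lp_operator_norm_def
proof (rule SUP_least, clarify)
  fix g assume g: "g \<in> Lp_space (1 / ennreal v) B" and g1: "Lp_norm (1 / ennreal v) B g \<le> 1"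
  have km: "T g \<in> borel_measurable A"
    using T g by (auto simp: Lp_linear_operator_def dest: Lp_space_measurable)
  have "Lp_norm (1 / ennreal v) A (T g) \<le> Lp_norm (1 / ennreal v) P (twisted_pullback u g)"
  proof (rule fiber_contraction(2)[OF finite_A proj_A marginal_A v twisted_pullback_Lp(1)[OF v u g] km])
    fix f :: "'a \<Rightarrow> complex" and C
    assume "f \<in> borel_measurable A" and "\<And>y. norm (f y) \<le> C"
    then have f: "f \<in> Lp_space (1 / ennreal (1 - v)) A"
      by (rule bounded_in_Lp_space[OF finite_A]) (use v in simp)
    show "integrable A (\<lambda>y. T g y * f y) \<and>
        integrable P (\<lambda>x. f ((\<lambda>(a, b, t). a) x) * twisted_pullback u g x) \<and>
        (\<integral>y. T g y * f y \<partial>A) = (\<integral>x. f ((\<lambda>(a, b, t). a) x) * twisted_pullback u g x \<partial>P)"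
      using S[unfolded represents_S_def, rule_format, OF g f]
      unfolding S_form_def S_integrand_eq by simp
  qed
  also have "\<dots> \<le> Lp_norm (1 / ennreal v) B g" by (rule twisted_pullback_Lp(2)[OF v u g])
  also note g1
  finally show "ennreal (Lp_norm (1 / ennreal v) A (T g)) \<le> 1" by simp
qed

end

theorem theorem6p3:
  fixes A :: "'a measure" and B :: "'b measure"
    and P :: "('a \<times> 'b \<times> real) measure"
    and v w :: real and u :: complex and p q :: ennreal
  assumes "lebesgue_space A" and "lebesgue_space B"
    and "P \<in> Pol A B"
    and "0 \<le> v" and "v \<le> 1"
    and "u = Complex v w"
    and "p = 1 / ennreal v" and "q = 1 / ennreal (1 - v)"
  shows "(\<exists>T. Lp_linear_operator p B A T \<and> represents_S u p q A B P T) \<and>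
         (\<forall>T. Lp_linear_operator p B A T \<and> represents_S u p q A B P T
            \<longrightarrow> Lp_operator_norm p B A T \<le> 1)"
proof -
  interpret polymorphism A B P
  proof (rule polymorphism.intro)
    show "finite_measure A" using assms(1) unfolding lebesgue_space_def by (rule conjunct1)
  qed (rule assms(3))
  have u: "Re u = v" using assms(6) by simp
  show ?thesis
    unfolding assms(7,8)
  proof (intro conjI exI allI impI)
    show "Lp_linear_operator (1 / ennreal v) B A (polymorphism_operator u)"
      by (rule polymorphism_operator_linear[OF assms(4,5) u])
    show "represents_S u (1 / ennreal v) (1 / ennreal (1 - v)) A B P (polymorphism_operator u)"
      by (rule polymorphism_operator_represents[OF assms(4,5) u])
  qed (auto intro: representing_operator_norm_le_1[OF assms(4,5) u])
qed

end
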